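(* Let $p,q>1$. Then: (1) The functions $r\mapsto K_{p,q}(r)$ and $r\mapsto\hat{K}_{p,q}(r)$ are strictly increasing and log-convex on $(0,1)$. Moreover, $r\mapsto K_{p,q}(r)$ and $r\mapsto\hat{K}_{p,q}(r)$ are strictly geometrically convex on $(0,1)$. (2) The function $r\mapsto E_{p,q}(r)$ is strictly decreasing and geometrically concave on $(0,1)$.
   Context: For $p,q>1$ and $r\in(0,1)$, define $$K_{p,q}(r)=\int_0^1\frac{dt}{(1-t^q)^{1/p}(1-r^qt^q)^{1-1/p}},\qquad \hat{K}_{p,q}(r)=\int_0^1\frac{dt}{(1-t^q)^{1/p}(1-r^qt^q)^{1/p}},$$ $$E_{p,q}(r)=\int_0^1\left(\frac{1-r^qt^q}{1-t^q}\right)^{1/p}dt.$$ A function $f:I\to(0,\infty)$ on an interval $I\subseteq(0,\infty)$ is log-convex if $f(\lambda x+(1-\lambda)y)\le f(x)^{\lambda}f(y)^{1-\lambda}$ for all $x,y\in I$ and $\lambda\in[0,1]$. It is geometrically convex if $f(x^{\lambda}y^{1-\lambda})\le f(x)^{\lambda}f(y)^{1-\lambda}$ for all $x,y\in I$ and $\lambda\in[0,1]$, strictly geometrically convex if this inequality is strict whenever $x\ne y$ and $\lambda\in(0,1)$, and geometrically concave if the (non-strict) inequality is reversed. *)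

theory Defs
  imports "HOL-Analysis.Analysis"
begin

(* The integrands below take the value 0 at t = 1 because of 0 powr a = 0 and
   x / 0 = 0; this single point does not affect the integrals. *)

definition K_pq :: "real \<Rightarrow> real \<Rightarrow> real \<Rightarrow> real" where
  "K_pq p q r = integral {0..1} (\<lambda>t.
     1 / ((1 - t powr q) powr (1 / p) * (1 - r powr q * t powr q) powr (1 - 1 / p)))"

definition K_hat_pq :: "real \<Rightarrow> real \<Rightarrow> real \<Rightarrow> real" where
  "K_hat_pq p q r = integral {0..1} (\<lambda>t.
     1 / ((1 - t powr q) powr (1 / p) * (1 - r powr q * t powr q) powr (1 / p)))"

definition E_pq :: "real \<Rightarrow> real \<Rightarrow> real \<Rightarrow> real" where
  "E_pq p q r = integral {0..1} (\<lambda>t.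
     ((1 - r powr q * t powr q) / (1 - t powr q)) powr (1 / p))"

(* The convexity notions apply to functions from I to the positive reals, where
   I is an interval of positive reals; this typing is part of each definition. *)

definition pos_fun_on :: "real set \<Rightarrow> (real \<Rightarrow> real) \<Rightarrow> bool" where
  "pos_fun_on I f \<longleftrightarrow> is_interval I \<and> I \<subseteq> {0<..} \<and> f \<in> I \<rightarrow> {0<..}"

definition log_convex_on :: "real set \<Rightarrow> (real \<Rightarrow> real) \<Rightarrow> bool" where
  "log_convex_on I f \<longleftrightarrow> pos_fun_on I f \<and>
     (\<forall>x\<in>I. \<forall>y\<in>I. \<forall>l\<in>{0..1}.
        f (l * x + (1 - l) * y) \<le> f x powr l * f y powr (1 - l))"

definition geom_convex_on :: "real set \<Rightarrow> (real \<Rightarrow> real) \<Rightarrow> bool" where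
  "geom_convex_on I f \<longleftrightarrow> pos_fun_on I f \<and>
     (\<forall>x\<in>I. \<forall>y\<in>I. \<forall>l\<in>{0..1}.
        f (x powr l * y powr (1 - l)) \<le> f x powr l * f y powr (1 - l))"

definition strict_geom_convex_on :: "real set \<Rightarrow> (real \<Rightarrow> real) \<Rightarrow> bool" where
  "strict_geom_convex_on I f \<longleftrightarrow> geom_convex_on I f \<and>
     (\<forall>x\<in>I. \<forall>y\<in>I. \<forall>l\<in>{0<..<1}. x \<noteq> y \<longrightarrow>
        f (x powr l * y powr (1 - l)) < f x powr l * f y powr (1 - l))"

definition geom_concave_on :: "real set \<Rightarrow> (real \<Rightarrow> real) \<Rightarrow> bool" where
  "geom_concave_on I f \<longleftrightarrow> pos_fun_on I f \<and>
     (\<forall>x\<in>I. \<forall>y\<in>I. \<forall>l\<in>{0..1}.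
        f (x powr l * y powr (1 - l)) \<ge> f x powr l * f y powr (1 - l))"

end

theory Submission
  imports Defs
begin

text \<open>All three integrals have the form \<open>\<integral> w(t) (1 - (r t)^q)^a dt\<close> with the integrable weight
  \<open>w(t) = (1 - t^q)^(-1/p)\<close>. Let \<open>a < 0\<close>, \<open>X = (x t)^q\<close> and \<open>Y = (y t)^q\<close>. Young's inequality for
  \<open>X, Y\<close> and for \<open>1 - X, 1 - Y\<close> shows that for each \<open>t\<close> the integrand is strictly geometrically
  convex in \<open>r\<close>; replacing the former by the convexity of \<open>s \<mapsto> s^q\<close> gives log-convexity.
  Hoelder's inequality transfers both properties to the integral. Log-concavity is not
  inherited in this way, but for \<open>0 < a \<le> 1\<close> the integrand is even concave as a function of
  \<open>ln r\<close>; hence so is the integral, and AM-GM gives geometric concavity.\<close>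

section \<open>Strict comparison of integrals and Hoelder's inequality\<close>

lemma integral_less_interior:
  fixes f g :: "real \<Rightarrow> real"
  assumes "f integrable_on {a..b}" "g integrable_on {a..b}" "a < b"
    and less: "\<And>x. x \<in> {a<..<b} \<Longrightarrow> f x < g x"
  shows "integral {a..b} f < integral {a..b} g"
proof -
  define d where "d = (\<lambda>x. g x - f x)"
  \<comment> \<open>The endpoints are null, and integrands belonging to different \<open>r\<close>
    agree at \<open>t = 0\<close> and \<open>t = 1\<close>, so strictness is to be had only
    inside.\<close>
  let ?S = "{a<..<b}"
  have "d integrable_on {a..b}"
    unfolding d_def using assms by (intro integrable_diff) auto
  hence "d integrable_on ?S"
    by (simp add: integrable_on_open_interval_real)
  \<comment> \<open>Positivity of \<open>d\<close> makes it absolutely integrable. This gives access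
    to the Lebesgue integral, where strict inequality on a space of positive measure carries over to
    the integrals.\<close>
  hence abs: "d absolutely_integrable_on ?S"
    using less by (intro nonnegative_absolutely_integrable_1) (auto simp: d_def less_imp_le)
  hence int: "integrable (lebesgue_on ?S) d"
    by (simp add: integrable_restrict_space set_integrable_def)
  interpret finite_measure "lebesgue_on ?S"
    by (rule finite_measure_lebesgue_on) auto
  have "integral\<^sup>L (lebesgue_on ?S) (\<lambda>_. 0) < integral\<^sup>L (lebesgue_on ?S) d"
    using int less \<open>a < b\<close>
    by (intro integral_less_AE_space) (auto simp: d_def emeasure_restrict_space)
  also have "integral\<^sup>L (lebesgue_on ?S) d = integral ?S d"
    using int by (intro lebesgue_integral_eq_integral) auto
  also have "\<dots> = integral {a..b} d"
    by (simp add: integral_open_interval_real)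
  also have "\<dots> = integral {a..b} g - integral {a..b} f"
    unfolding d_def using assms by (intro integral_diff) auto
  finally show ?thesis by simp
qed

lemma young_scaled:
  fixes a b :: real
  assumes "a \<ge> 0" "b \<ge> 0" "A > 0" "B > 0" "l \<in> {0..1}"
  shows "a powr l * b powr (1 - l) \<le> A powr l * B powr (1 - l) * (l * (a / A) + (1 - l) * (b / B))"
\<comment> \<open>A zero factor makes the left side 0 even for exponent 0, since
  \<open>0 powr 0 = 0\<close>.\<close>
proof (cases "a = 0 \<or> b = 0")
  case True
  then show ?thesis using assms by auto
next
  case False
  hence "(a / A) powr l * (b / B) powr (1 - l) \<le> l * (a / A) + (1 - l) * (b / B)"
    using assms by (intro Youngs_inequality_0) auto
  hence "A powr l * B powr (1 - l) * ((a / A) powr l * (b / B) powr (1 - l))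
     \<le> A powr l * B powr (1 - l) * (l * (a / A) + (1 - l) * (b / B))"
    by (intro mult_left_mono) auto
  thus ?thesis using assms by (simp add: powr_divide)
qed

text \<open>Young's inequality is applied to \<open>f\<close> and \<open>g\<close> normalised by
  their integrals. The majorant is linear in \<open>f\<close> and \<open>g\<close>, so its integral
  is explicit and integrability of the product of powers never has to be discussed.\<close>

lemma Holder_majorant:
  fixes f g :: "real \<Rightarrow> real"
  assumes int: "f integrable_on S" "g integrable_on S"
    and pos: "integral S f > 0" "integral S g > 0" and l: "l \<in> {0..1}"
    and nonneg: "\<And>x. x \<in> S \<Longrightarrow> f x \<ge> 0 \<and> g x \<ge> 0"
  obtains k where "(k has_integral integral S f powr l * integral S g powr (1 - l)) S"
    and "\<And>x. x \<in> S \<Longrightarrow> f x powr l * g x powr (1 - l) \<le> k x"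
proof
  define A B where "A = integral S f" and "B = integral S g"
  let ?k = "\<lambda>x. A powr l * B powr (1 - l) * (l * (f x / A) + (1 - l) * (g x / B))"
  have "(?k has_integral A powr l * B powr (1 - l) * (l * (A / A) + (1 - l) * (B / B))) S"
    unfolding A_def B_def
    by (intro has_integral_mult_right has_integral_add has_integral_divide integrable_integral int)
  thus "(?k has_integral integral S f powr l * integral S g powr (1 - l)) S"
    using pos by (simp add: A_def B_def)
  show "f x powr l * g x powr (1 - l) \<le> ?k x" if "x \<in> S" for x
    using young_scaled[of "f x" "g x" A B l] nonneg[OF that] pos l by (simp add: A_def B_def)
qed

lemma Holder_integral_le:
  fixes f g h :: "real \<Rightarrow> real"
  assumes int: "f integrable_on S" "g integrable_on S" "h integrable_on S"
    and pos: "integral S f > 0" "integral S g > 0" and l: "l \<in> {0..1}"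
    and nonneg: "\<And>x. x \<in> S \<Longrightarrow> f x \<ge> 0 \<and> g x \<ge> 0"
    and le: "\<And>x. x \<in> S \<Longrightarrow> h x \<le> f x powr l * g x powr (1 - l)"
  shows "integral S h \<le> integral S f powr l * integral S g powr (1 - l)"
proof -
  obtain k where k: "(k has_integral integral S f powr l * integral S g powr (1 - l)) S"
    and fgk: "\<And>x. x \<in> S \<Longrightarrow> f x powr l * g x powr (1 - l) \<le> k x"
    using Holder_majorant[OF int(1,2) pos l nonneg] by blast
  show ?thesis
    using order_trans[OF le fgk] by (intro has_integral_le[OF integrable_integral[OF int(3)] k])
qed

lemma Holder_integral_less:
  fixes f g h :: "real \<Rightarrow> real"
  assumes int: "f integrable_on {a..b}" "g integrable_on {a..b}" "h integrable_on {a..b}"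
    and "a < b"
    and pos: "integral {a..b} f > 0" "integral {a..b} g > 0" and l: "l \<in> {0..1}"
    and nonneg: "\<And>x. x \<in> {a..b} \<Longrightarrow> f x \<ge> 0 \<and> g x \<ge> 0"
    and less: "\<And>x. x \<in> {a<..<b} \<Longrightarrow> h x < f x powr l * g x powr (1 - l)"
  shows "integral {a..b} h < integral {a..b} f powr l * integral {a..b} g powr (1 - l)"
proof -
  obtain k where k: "(k has_integral integral {a..b} f powr l * integral {a..b} g powr (1 - l)) {a..b}"
    and fgk: "\<And>x. x \<in> {a..b} \<Longrightarrow> f x powr l * g x powr (1 - l) \<le> k x"
    using Holder_majorant[OF int(1,2) pos l nonneg] by blast
  have "integral {a..b} h < integral {a..b} k"
    using order.strict_trans2[OF less fgk] k int \<open>a < b\<close>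
    by (intro integral_less_interior) auto
  thus ?thesis using k by (simp add: integral_unique)
qed

section \<open>Young's inequality and powers of weighted means\<close>

lemma Youngs_inequality_strict:
  fixes a b :: real
  assumes "a > 0" "b > 0" "a \<noteq> b" "l \<in> {0<..<1}"
  shows "a powr l * b powr (1 - l) < l * a + (1 - l) * b"
proof -
  define s where "s = l * a + (1 - l) * b"
  have s: "s > 0" using assms by (auto simp: s_def intro: add_pos_pos)
  \<comment> \<open>The graph of \<open>ln\<close> lies below its tangent at the weighted mean
    \<open>s\<close> and touches it only there; weighting the bounds at \<open>a\<close> and
    \<open>b\<close> cancels the linear terms.\<close>
  have ln_le: "ln x \<le> ln s + (x - s) / s" if "x > 0" for x
    using ln_le_minus_one[of "x / s"] that s by (simp add: ln_div diff_divide_distrib)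
  have "a \<noteq> s"
  proof
    assume "a = s"
    hence "(1 - l) * (a - b) = 0" by (simp add: s_def algebra_simps)
    thus False using assms by auto
  qed
  hence a: "ln a < ln s + (a - s) / s"
    using ln_le[of a] ln_eq_minus_one[of "a / s"] assms s
    by (auto simp: ln_div diff_divide_distrib order.strict_iff_order)
  have "l * ln a + (1 - l) * ln b < l * (ln s + (a - s) / s) + (1 - l) * (ln s + (b - s) / s)"
    using assms a ln_le[of b] by (intro add_less_le_mono mult_strict_left_mono mult_left_mono) auto
  also have "\<dots> = ln s + (l * a + (1 - l) * b - s) / s"
    using s by (simp add: field_simps)
  also have "\<dots> = ln s" by (simp add: s_def)
  finally have "exp (l * ln a + (1 - l) * ln b) < exp (ln s)" by (subst exp_less_cancel_iff)
  thus ?thesis using assms s by (simp add: powr_def exp_add s_def)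
qed

text \<open>Young's inequality bounds the geometric means of \<open>x, y\<close> and of
  \<open>1 - x, 1 - y\<close> by the corresponding arithmetic means, and these two add up to
  1.\<close>

lemma one_minus_geom_mean_ge:
  fixes x y :: real
  assumes "x \<in> {0<..<1}" "y \<in> {0<..<1}" "l \<in> {0..1}"
  shows "(1 - x) powr l * (1 - y) powr (1 - l) \<le> 1 - x powr l * y powr (1 - l)"
  using Youngs_inequality_0[of l "1 - l" x y] Youngs_inequality_0[of l "1 - l" "1 - x" "1 - y"] assms
  by (auto simp: algebra_simps)

lemma one_minus_geom_mean_gt:
  fixes x y :: real
  assumes "x \<in> {0<..<1}" "y \<in> {0<..<1}" "l \<in> {0<..<1}" "x \<noteq> y"
  shows "(1 - x) powr l * (1 - y) powr (1 - l) < 1 - x powr l * y powr (1 - l)"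
  using Youngs_inequality_strict[of x y l] Youngs_inequality_strict[of "1 - x" "1 - y" l] assms
  by (auto simp: algebra_simps)

lemma powr_le_self:
  fixes x :: real
  assumes "x \<in> {0..1}" "q \<ge> 1"
  shows "x powr q \<le> x"
  using powr_mono'[of 1 q x] assms by simp

lemma powr_convex_nonneg:
  fixes x y :: real
  assumes "x \<ge> 0" "y \<ge> 0" "l \<in> {0..1}" "q \<ge> 1"
  shows "(l * x + (1 - l) * y) powr q \<le> l * x powr q + (1 - l) * y powr q"
proof -
  \<comment> \<open>This is convexity when one of the two points is 0; it comes from
    \<open>c powr q <= c\<close>.\<close>
  have scaled: "(c * z) powr q \<le> c * z powr q" if "c \<in> {0..1}" "z \<ge> 0" for c z :: real
    using that powr_le_self[of c q] assms by (simp add: powr_mult mult_right_mono)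
  consider "x = 0" | "y = 0" | "x > 0" "y > 0" using assms by force
  thus ?thesis
  proof cases
    case 3
    with convex_onD[OF powr_convex[OF \<open>q \<ge> 1\<close>], of "1 - l" x y] assms
    show ?thesis by simp
  qed (use assms scaled[of l x] scaled[of "1 - l" y] in auto)
qed

lemma powr_concave_nonneg:
  fixes x y :: real
  assumes "x \<ge> 0" "y \<ge> 0" "l \<in> {0..1}" "b \<in> {0<..1}"
  shows "l * x powr b + (1 - l) * y powr b \<le> (l * x + (1 - l) * y) powr b"
proof -
  \<comment> \<open>Concavity of the power \<open>b\<close> is convexity of its inverse, the power
    \<open>1 / b\<close>, at the points \<open>x powr b\<close> and \<open>y powr b\<close>.\<close>
  have "(l * x powr b + (1 - l) * y powr b) powr (1 / b) \<le> l * x + (1 - l) * y"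
    using powr_convex_nonneg[of "x powr b" "y powr b" l "1 / b"] assms
    by (simp add: powr_powr)
  hence "((l * x powr b + (1 - l) * y powr b) powr (1 / b)) powr b \<le> (l * x + (1 - l) * y) powr b"
    using assms by (intro powr_mono2) auto
  thus ?thesis using assms by (simp add: powr_powr)
qed

lemma geom_mean_in_unit:
  fixes x y :: real
  assumes "x \<in> {0<..<1}" "y \<in> {0<..<1}" "l \<in> {0..1}"
  shows "x powr l * y powr (1 - l) \<in> {0<..<1}"
proof -
  have "x powr l * y powr (1 - l) \<le> l * x + (1 - l) * y"
    using Youngs_inequality_0[of l "1 - l" x y] assms by auto
  also have "\<dots> < 1" using assms by (intro convex_bound_lt) auto
  finally show ?thesis using assms by auto
qed

section \<open>The common family of integrals and integrability of its integrands\<close>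

definition pq_weight :: "real \<Rightarrow> real \<Rightarrow> real \<Rightarrow> real" where
  "pq_weight p q t = 1 / (1 - t powr q) powr (1 / p)"

definition pq_integral :: "real \<Rightarrow> real \<Rightarrow> real \<Rightarrow> real \<Rightarrow> real" where
  "pq_integral p q a r = integral {0..1} (\<lambda>t. pq_weight p q t * (1 - (r * t) powr q) powr a)"

text \<open>These identities hold for all arguments, since \<open>powr\<close> is multiplicative on all of \<open>\<real>\<close>
  (\<open>ln\<close> of a negative number is \<open>ln\<close> of its absolute value).\<close>

lemma K_pq_eq_pq_integral: "K_pq p q = pq_integral p q (1 / p - 1)"
  using powr_minus_divide[of _ "1 - 1 / p"]
  by (simp add: fun_eq_iff K_pq_def pq_integral_def pq_weight_def powr_mult)

lemma K_hat_pq_eq_pq_integral: "K_hat_pq p q = pq_integral p q (- (1 / p))"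
  by (simp add: fun_eq_iff K_hat_pq_def pq_integral_def pq_weight_def powr_mult powr_minus_divide)

lemma E_pq_eq_pq_integral: "E_pq p q = pq_integral p q (1 / p)"
  by (simp add: fun_eq_iff E_pq_def pq_integral_def pq_weight_def powr_mult powr_divide)

lemma powr_less_one_unit: "(t::real) powr q < 1" if "0 \<le> t" "t < 1" "q > 0"
  using powr_less_mono2[of q t 1] that by simp

locale pq_exponents =
  fixes p q :: real
  assumes p: "p > 1" and q: "q > 1"
begin

lemma pq_weight_nonneg: "pq_weight p q t \<ge> 0"
  by (simp add: pq_weight_def)

lemma pq_weight_pos: "t \<in> {0<..<1} \<Longrightarrow> pq_weight p q t > 0"
  using powr_less_one_unit[of t q] q by (auto simp: pq_weight_def)

text \<open>From \<open>t powr q <= t\<close> the weight is at most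
  \<open>(1 - t) powr (- (1 / p))\<close>, whose singularity at 1 is integrable because
  \<open>1 / p < 1\<close>.\<close>

lemma pq_weight_absolutely_integrable: "pq_weight p q absolutely_integrable_on {0..1}"
proof (rule measurable_bounded_by_integrable_imp_absolutely_integrable)
  have "pq_weight p q \<in> borel_measurable borel"
    unfolding pq_weight_def by measurable
  thus "pq_weight p q \<in> borel_measurable (lebesgue_on {0..1})"
    by (simp add: borel_measurable_if_D measurable_completion measurable_restrict_space1)
next
  define b where "b = 1 / p"
  have b: "b \<in> {0<..<1}" using p by (auto simp: b_def)
  have "((\<lambda>t. (1 - t) powr (- b)) has_integral
      (- ((1 - 1) powr (1 - b) / (1 - b))) - (- ((1 - 0) powr (1 - b) / (1 - b)))) {0..1}"
  \<comment> \<open>The antiderivative is continuous up to \<open>t = 1\<close>, where the integrand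
    is singular, so derivatives are taken only in the interior.\<close>
  proof (rule fundamental_theorem_of_calculus_interior)
    show "continuous_on {0..1} (\<lambda>t::real. - ((1 - t) powr (1 - b) / (1 - b)))"
      using b by (intro continuous_intros continuous_on_powr') auto
    show "((\<lambda>t. - ((1 - t) powr (1 - b) / (1 - b))) has_vector_derivative (1 - t) powr (- b)) (at t)"
      if "t \<in> {0<..<1}" for t
      unfolding has_real_derivative_iff_has_vector_derivative[symmetric] using that b
      by (auto intro!: derivative_eq_intros)
  qed simp
  thus "(\<lambda>t. (1 - t) powr (- (1 / p))) integrable_on {0..1}"
    by (auto simp: b_def integrable_on_def)
next
  fix t :: real assume t: "t \<in> {0..1}"
  show "norm (pq_weight p q t) \<le> (1 - t) powr (- (1 / p))"
  proof (cases "t = 1")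
    case False
    have "t powr q \<le> t"
      using t q by (intro powr_le_self) auto
    hence "(1 - t) powr (1 / p) \<le> (1 - t powr q) powr (1 / p)"
      using t p by (intro powr_mono2) auto
    thus ?thesis using t False
      by (auto simp: pq_weight_def powr_minus_divide intro!: frac_le)
  qed (simp add: pq_weight_def)
qed auto

lemma base_less_one:
  assumes "r \<in> {0<..<1}" "t \<in> {0..1}"
  shows "(r * t) powr q < 1"
proof (rule powr_less_one_unit)
  show "r * t < 1" using assms by (intro le_less_trans[OF mult_left_le]) auto
qed (use assms q in auto)

lemma base_in_unit:
  assumes "r \<in> {0<..<1}" "t \<in> {0<..<1}"
  shows "(r * t) powr q \<in> {0<..<1}"
  using base_less_one[of r t] assms by auto

text \<open>Since \<open>r < 1\<close>, the base \<open>1 - (r * t) powr q\<close> stays away from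
  0. Its power is thus continuous and bounded on the closed interval for either sign of
  \<open>a\<close>, and only the weight is singular.\<close>

lemma integrand_integrable:
  assumes "r \<in> {0<..<1}"
  shows "(\<lambda>t. pq_weight p q t * (1 - (r * t) powr q) powr a) integrable_on {0..1}"
proof -
  have cont: "continuous_on {0..1} (\<lambda>t. (1 - (r * t) powr q) powr a)"
  proof (rule continuous_on_powr[OF continuous_on_diff[OF continuous_on_const] continuous_on_const])
    show "continuous_on {0..1} (\<lambda>t. (r * t) powr q)"
      using assms q by (intro continuous_on_powr' continuous_intros) auto
    show "\<forall>t\<in>{0..1}. 1 - (r * t) powr q \<noteq> 0"
      using base_less_one[OF assms] by force
  qed
  have "(\<lambda>t. (1 - (r * t) powr q) powr a * pq_weight p q t) absolutely_integrable_on {0..1}"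
    by (intro absolutely_integrable_bounded_measurable_product_real pq_weight_absolutely_integrable
        continuous_imp_measurable_on_sets_lebesgue cont compact_imp_bounded
        compact_continuous_image) auto
  thus ?thesis by (simp add: mult.commute absolutely_integrable_on_def)
qed

section \<open>Positivity and monotonicity in \<open>r\<close>\<close>

lemma pq_integral_pos:
  assumes "r \<in> {0<..<1}"
  shows "pq_integral p q a r > 0"
proof -
  have "integral {0..1} (\<lambda>_::real. 0 :: real) < pq_integral p q a r"
    unfolding pq_integral_def
  proof (intro integral_less_interior integrand_integrable assms)
    fix t :: real assume "t \<in> {0<..<1}"
    thus "0 < pq_weight p q t * (1 - (r * t) powr q) powr a"
      using base_in_unit[OF assms, of t] pq_weight_pos[of t] by auto
  qed auto
  thus ?thesis by simp
qed

lemma base_strict_mono: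
  assumes "0 < r" "r < s" "t \<in> {0<..<1}"
  shows "(r * t) powr q < (s * t) powr q"
  using assms q by (intro powr_less_mono2) auto

lemma pq_integral_strict_mono:
  assumes "a < 0"
  shows "strict_mono_on {0<..<1} (pq_integral p q a)"
proof (rule strict_mono_onI)
  fix r s :: real assume rs: "r \<in> {0<..<1}" "s \<in> {0<..<1}" "r < s"
  show "pq_integral p q a r < pq_integral p q a s"
    unfolding pq_integral_def
  proof (intro integral_less_interior integrand_integrable rs mult_strict_left_mono pq_weight_pos)
    fix t :: real assume t: "t \<in> {0<..<1}"
    show "(1 - (r * t) powr q) powr a < (1 - (s * t) powr q) powr a"
      using base_strict_mono[of r s t] base_in_unit[of s t] rs t assms
      by (intro powr_less_mono2_neg) auto
  qed auto
qed

lemma pq_integral_strict_antimono: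
  assumes "a > 0"
  shows "strict_antimono_on {0<..<1} (pq_integral p q a)"
proof (rule monotone_onI)
  fix r s :: real assume rs: "r \<in> {0<..<1}" "s \<in> {0<..<1}" "r < s"
  show "pq_integral p q a s < pq_integral p q a r"
    unfolding pq_integral_def
  proof (intro integral_less_interior integrand_integrable rs mult_strict_left_mono pq_weight_pos)
    fix t :: real assume t: "t \<in> {0<..<1}"
    show "(1 - (s * t) powr q) powr a < (1 - (r * t) powr q) powr a"
      using base_strict_mono[of r s t] base_in_unit[of s t] rs t assms
      by (intro powr_less_mono2) auto
  qed auto
qed

section \<open>Log-convexity and strict geometric convexity for negative exponents\<close>

lemma pq_integral_pos_fun: "pos_fun_on {0<..<1} (pq_integral p q a)"
  using pq_integral_pos by (auto simp: pos_fun_on_def is_interval_oo)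

text \<open>The exponents \<open>l\<close> and \<open>1 - l\<close> add up to 1, so the weight
  survives unchanged and comparing integrands reduces to comparing the bases of the power
  \<open>a\<close>.\<close>

lemma integrand_geom_mean:
  assumes "r \<in> {0<..<1}" "s \<in> {0<..<1}" "t \<in> {0..1}"
  shows "(pq_weight p q t * (1 - (r * t) powr q) powr a) powr l *
     (pq_weight p q t * (1 - (s * t) powr q) powr a) powr (1 - l) =
     pq_weight p q t * ((1 - (r * t) powr q) powr l * (1 - (s * t) powr q) powr (1 - l)) powr a"
proof -
  have "pq_weight p q t powr l * pq_weight p q t powr (1 - l) = pq_weight p q t"
    using pq_weight_nonneg[of t] by (simp flip: powr_add)
  thus ?thesis using base_less_one[of r t] base_less_one[of s t] assms pq_weight_nonneg[of t]
    by (simp add: powr_mult powr_powr mult.commute mult.left_commute)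
qed

lemma base_geom_mean:
  assumes "r \<ge> 0" "s \<ge> 0" "t \<ge> 0"
  shows "(r powr l * s powr (1 - l) * t) powr q =
    ((r * t) powr q) powr l * ((s * t) powr q) powr (1 - l)"
proof -
  have "t powr (q * l) * t powr (q * (1 - l)) = t powr q"
    by (simp add: algebra_simps flip: powr_add)
  hence "t powr (l * q) * t powr ((1 - l) * q) = t powr q" by (simp add: mult.commute)
  thus ?thesis
    using assms by (simp add: powr_mult powr_powr mult_ac)
qed

text \<open>For \<open>a < 0\<close> the power \<open>a\<close> is decreasing, so a lower bound on
  \<open>1 - (u * t) powr q\<close> is an upper bound on the integrand, to which Hoelder applies.
  The point \<open>u\<close> is left free: it becomes the arithmetic mean for log-convexity and the
  geometric mean for geometric convexity.\<close>

lemma pq_integral_Holder_le: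
  assumes "r \<in> {0<..<1}" "s \<in> {0<..<1}" "u \<in> {0<..<1}" "l \<in> {0..1}" "a < 0"
    and ge: "\<And>t. t \<in> {0<..<1} \<Longrightarrow> (1 - (r * t) powr q) powr l * (1 - (s * t) powr q) powr (1 - l)
                 \<le> 1 - (u * t) powr q"
  shows "pq_integral p q a u \<le> pq_integral p q a r powr l * pq_integral p q a s powr (1 - l)"
  unfolding pq_integral_def
proof (intro Holder_integral_le integrand_integrable pq_integral_pos[unfolded pq_integral_def])
  fix t :: real assume t: "t \<in> {0..1}"
  \<comment> \<open>The hypothesis covers only the interior. At \<open>t = 0\<close> both sides are
    1; at \<open>t = 1\<close> the weight is 0.\<close>
  have "(1 - (u * t) powr q) powr a \<le>
     ((1 - (r * t) powr q) powr l * (1 - (s * t) powr q) powr (1 - l)) powr a" if "t \<noteq> 1"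
    using ge[of t] base_less_one[of r t] base_less_one[of s t] assms t that
    by (cases "t = 0") (auto intro!: powr_mono2')
  thus "pq_weight p q t * (1 - (u * t) powr q) powr a \<le>
     (pq_weight p q t * (1 - (r * t) powr q) powr a) powr l *
     (pq_weight p q t * (1 - (s * t) powr q) powr a) powr (1 - l)"
    unfolding integrand_geom_mean[OF assms(1,2) t]
    by (cases "t = 1") (auto simp: pq_weight_def intro: divide_right_mono)
qed (use assms pq_weight_nonneg in auto)

lemma pq_integral_Holder_less:
  assumes "r \<in> {0<..<1}" "s \<in> {0<..<1}" "u \<in> {0<..<1}" "l \<in> {0..1}" "a < 0"
    and gt: "\<And>t. t \<in> {0<..<1} \<Longrightarrow> (1 - (r * t) powr q) powr l * (1 - (s * t) powr q) powr (1 - l)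
                 < 1 - (u * t) powr q"
  shows "pq_integral p q a u < pq_integral p q a r powr l * pq_integral p q a s powr (1 - l)"
  unfolding pq_integral_def
proof (intro Holder_integral_less integrand_integrable pq_integral_pos[unfolded pq_integral_def])
  fix t :: real assume t: "t \<in> {0<..<1}"
  have "(1 - (u * t) powr q) powr a <
     ((1 - (r * t) powr q) powr l * (1 - (s * t) powr q) powr (1 - l)) powr a"
    using gt[of t] base_in_unit[of r t] base_in_unit[of s t] assms t
    by (intro powr_less_mono2_neg) auto
  thus "pq_weight p q t * (1 - (u * t) powr q) powr a <
     (pq_weight p q t * (1 - (r * t) powr q) powr a) powr l *
     (pq_weight p q t * (1 - (s * t) powr q) powr a) powr (1 - l)"
    using t pq_weight_pos[OF t] by (subst integrand_geom_mean[OF assms(1,2)]) auto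
qed (use assms pq_weight_nonneg in auto)

lemma pq_integral_log_convex:
  assumes "a < 0"
  shows "log_convex_on {0<..<1} (pq_integral p q a)"
  unfolding log_convex_on_def
proof (intro conjI pq_integral_pos_fun ballI)
  fix r s l :: real assume rs: "r \<in> {0<..<1}" "s \<in> {0<..<1}" and l: "l \<in> {0..1}"
  have u: "l * r + (1 - l) * s \<in> {0<..<1}"
    using convexD[OF convex_real_interval(8)[of 0 1] rs, of l "1 - l"] l by auto
  show "pq_integral p q a (l * r + (1 - l) * s)
      \<le> pq_integral p q a r powr l * pq_integral p q a s powr (1 - l)"
  proof (rule pq_integral_Holder_le[OF rs u l assms])
    fix t :: real assume t: "t \<in> {0<..<1}"
    have "((l * r + (1 - l) * s) * t) powr q \<le> l * (r * t) powr q + (1 - l) * (s * t) powr q"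
      using powr_convex_nonneg[of "r * t" "s * t" l q] rs t l q by (simp add: algebra_simps)
    moreover have "(1 - (r * t) powr q) powr l * (1 - (s * t) powr q) powr (1 - l)
        \<le> l * (1 - (r * t) powr q) + (1 - l) * (1 - (s * t) powr q)"
      using base_in_unit[OF rs(1) t] base_in_unit[OF rs(2) t] l
      by (intro Youngs_inequality_0) auto
    \<comment> \<open>The last bound equals 1 minus the arithmetic mean of the two bases, which is
      the bound of the first estimate.\<close>
    ultimately show "(1 - (r * t) powr q) powr l * (1 - (s * t) powr q) powr (1 - l)
                 \<le> 1 - ((l * r + (1 - l) * s) * t) powr q"
      by (simp add: algebra_simps)
  qed
qed

lemma pq_integral_strict_geom_convex:
  assumes "a < 0"
  shows "strict_geom_convex_on {0<..<1} (pq_integral p q a)"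
  unfolding strict_geom_convex_on_def geom_convex_on_def
proof (intro conjI pq_integral_pos_fun ballI impI)
  fix r s l :: real assume rs: "r \<in> {0<..<1}" "s \<in> {0<..<1}" and l: "l \<in> {0..1}"
  show "pq_integral p q a (r powr l * s powr (1 - l))
      \<le> pq_integral p q a r powr l * pq_integral p q a s powr (1 - l)"
  proof (rule pq_integral_Holder_le[OF rs geom_mean_in_unit[OF rs l] l assms])
    fix t :: real assume t: "t \<in> {0<..<1}"
    show "(1 - (r * t) powr q) powr l * (1 - (s * t) powr q) powr (1 - l)
        \<le> 1 - (r powr l * s powr (1 - l) * t) powr q"
      using one_minus_geom_mean_ge[OF base_in_unit[OF rs(1) t] base_in_unit[OF rs(2) t] l] rs t
      by (simp add: base_geom_mean)
  qed
next
  fix r s l :: real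
  assume rs: "r \<in> {0<..<1}" "s \<in> {0<..<1}" and l: "l \<in> {0<..<1}" and "r \<noteq> s"
  have l': "l \<in> {0..1}" using l by auto
  show "pq_integral p q a (r powr l * s powr (1 - l))
      < pq_integral p q a r powr l * pq_integral p q a s powr (1 - l)"
  proof (rule pq_integral_Holder_less[OF rs geom_mean_in_unit[OF rs l'] l' assms])
    fix t :: real assume t: "t \<in> {0<..<1}"
    \<comment> \<open>Distinct \<open>r\<close> and \<open>s\<close> give distinct bases at every
      interior \<open>t\<close>, so Young's inequality is strict throughout.\<close>
    have "(r * t) powr q \<noteq> (s * t) powr q"
      using base_strict_mono[of r s t] base_strict_mono[of s r t] rs t \<open>r \<noteq> s\<close>
      by (cases r s rule: linorder_cases) auto
    thus "(1 - (r * t) powr q) powr l * (1 - (s * t) powr q) powr (1 - l)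
        < 1 - (r powr l * s powr (1 - l) * t) powr q"
      using one_minus_geom_mean_gt[OF base_in_unit[OF rs(1) t] base_in_unit[OF rs(2) t] l] rs t
      by (simp add: base_geom_mean)
  qed
qed

section \<open>Geometric concavity for positive exponents up to 1\<close>

lemma pq_integral_geom_concave:
  assumes "a \<in> {0<..1}"
  shows "geom_concave_on {0<..<1} (pq_integral p q a)"
  unfolding geom_concave_on_def
proof (intro conjI pq_integral_pos_fun ballI)
  fix r s l :: real assume rs: "r \<in> {0<..<1}" "s \<in> {0<..<1}" and l: "l \<in> {0..1}"
  define u where "u = r powr l * s powr (1 - l)"
  have u: "u \<in> {0<..<1}" unfolding u_def by (rule geom_mean_in_unit[OF rs l])
  define f where "f = (\<lambda>r t. pq_weight p q t * (1 - (r * t) powr q) powr a)"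
  have "pq_integral p q a r powr l * pq_integral p q a s powr (1 - l)
      \<le> l * pq_integral p q a r + (1 - l) * pq_integral p q a s"
    using rs l by (intro Youngs_inequality_0 pq_integral_pos) auto
  also have "\<dots> = integral {0..1} (\<lambda>t. l * f r t + (1 - l) * f s t)"
    unfolding pq_integral_def f_def using integrand_integrable rs
    by (subst integral_add) (auto intro!: integrable_on_mult_right)
  also have "\<dots> \<le> integral {0..1} (f u)"
  proof (rule integral_le)
    show "(\<lambda>t. l * f r t + (1 - l) * f s t) integrable_on {0..1}" "f u integrable_on {0..1}"
      unfolding f_def using integrand_integrable rs u
      by (auto intro!: integrable_add integrable_on_mult_right)
  next
    fix t :: real assume t: "t \<in> {0..1}"
    have *: "l * (1 - (r * t) powr q) powr a + (1 - l) * (1 - (s * t) powr q) powr a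
        \<le> (1 - (u * t) powr q) powr a"
    \<comment> \<open>Young's inequality is applied to positive bases; at \<open>t = 0\<close> both
      sides are simply 1.\<close>
    proof (cases "t = 0")
      case False
      have "(u * t) powr q \<le> l * (r * t) powr q + (1 - l) * (s * t) powr q"
        unfolding u_def using rs t l False
        by (subst base_geom_mean) (auto intro!: Youngs_inequality_0)
      moreover have "0 \<le> l * (1 - (r * t) powr q) + (1 - l) * (1 - (s * t) powr q)"
        using l base_less_one[OF rs(1) t] base_less_one[OF rs(2) t] by auto
      \<comment> \<open>Here \<open>a > 0\<close> makes the power increasing; \<open>a <= 1\<close>
        enters next, through its concavity.\<close>
      ultimately have "(l * (1 - (r * t) powr q) + (1 - l) * (1 - (s * t) powr q)) powr a
          \<le> (1 - (u * t) powr q) powr a"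
        using assms by (intro powr_mono2) (auto simp: algebra_simps)
      thus ?thesis
        using powr_concave_nonneg[of "1 - (r * t) powr q" "1 - (s * t) powr q" l a]
          l assms base_less_one[OF rs(1) t] base_less_one[OF rs(2) t] by auto
    qed (use q in auto)
    show "l * f r t + (1 - l) * f s t \<le> f u t"
      using mult_left_mono[OF * pq_weight_nonneg[of t]] by (simp add: f_def algebra_simps)
  qed
  also have "\<dots> = pq_integral p q a u" by (simp add: pq_integral_def f_def)
  finally show "pq_integral p q a r powr l * pq_integral p q a s powr (1 - l)
      \<le> pq_integral p q a (r powr l * s powr (1 - l))"
    by (simp add: u_def)
qed

end

theorem theorem2p6:
  fixes p q :: real
  assumes "p > 1" and "q > 1"
  shows "(strict_mono_on {0<..<1} (K_pq p q) \<and> strict_mono_on {0<..<1} (K_hat_pq p q) \<and>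
          log_convex_on {0<..<1} (K_pq p q) \<and> log_convex_on {0<..<1} (K_hat_pq p q) \<and>
          strict_geom_convex_on {0<..<1} (K_pq p q) \<and>
          strict_geom_convex_on {0<..<1} (K_hat_pq p q)) \<and>
         (strict_antimono_on {0<..<1} (E_pq p q) \<and> geom_concave_on {0<..<1} (E_pq p q))"
proof -
  interpret pq_exponents p q using assms by unfold_locales
  show ?thesis
    unfolding K_pq_eq_pq_integral K_hat_pq_eq_pq_integral E_pq_eq_pq_integral using assms
    by (intro conjI pq_integral_strict_mono pq_integral_log_convex pq_integral_strict_geom_convex
        pq_integral_strict_antimono pq_integral_geom_concave)
      auto
qed

end
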